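(* Let $d \geq 1$ be an integer and let $\mathbb R^n = \mathbb R^{n_1}\times\cdots\times\mathbb R^{n_d}$ be decomposed into $d$ blocks of coordinates. Let $f:\mathbb R^n\to\mathbb R$ be a convex differentiable function such that, for each $i\in\{1,\dots,d\}$, the $i$th (block) partial derivative of $f$ is $L_i$-Lipschitz continuous along block $i$, with $L_i>0$, i.e. $\|\nabla_i f(x+U_i h)-\nabla_i f(x)\|\leq L_i\|h\|$ for all $x\in\mathbb R^n$, $h\in\mathbb R^{n_i}$. Let $x_*$ be a minimizer of $f$ and let $x_0\in\mathbb R^n$. Let $I_1$ be uniformly distributed on $\{1,\dots,d\}$ and let $$x_1 = x_0-\frac{1}{L_{I_1}}\,U_{I_1}\nabla_{I_1} f(x_0).$$ Then $$\mathbb E\Big[(d-1)\big(f(x_1)-f(x_* )\big)+\frac d2\|x_1-x_*\|_L^2\Big]\leq (d-2)\big(f(x_0)-f(x_* )\big)+\frac d2\|x_0-x_*\|_L^2 .$$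
   Context: For $i\in\{1,\dots,d\}$, $U_i\in\mathbb R^{n\times n_i}$ is the submatrix of the $n\times n$ identity matrix formed by the columns corresponding to block $i$, $x^{(i)}=U_i^\top x\in\mathbb R^{n_i}$ is the $i$th block of $x$, and $\nabla_i f(x)=U_i^\top\nabla f(x)$ is the $i$th block of the gradient. $\|\cdot\|$ is the Euclidean norm. The weighted norm is $\|x\|_L=\big(\sum_{i=1}^d L_i\|x^{(i)}\|^2\big)^{1/2}$. The expectation is with respect to the random index $I_1$ (with $x_0$ and $x_*$ deterministic). The point $x_1$ is the result of one iteration of randomized coordinate gradient descent started from $x_0$. *)

theory Defs
  imports "HOL-Probability.Probability"
begin

definition gradient :: "('a::real_inner \<Rightarrow> real) \<Rightarrow> 'a \<Rightarrow> 'a"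
  where "gradient f x = (THE D. GDERIV f x :> D)"

lemma GDERIV_gradient:
  fixes f :: "'a::euclidean_space \<Rightarrow> real"
  assumes "f differentiable (at x)"
  shows "GDERIV f x :> gradient f x"
proof -
  from assms obtain f' where f': "(f has_derivative f') (at x)"
    unfolding differentiable_def by blast
  have "f' = (\<lambda>h. h \<bullet> (\<Sum>b\<in>Basis. f' b *\<^sub>R b))"
  proof (rule ext)
    fix h
    have lin: "linear f'"
      using f' by (simp add: has_derivative_linear)
    have "f' h = f' (\<Sum>b\<in>Basis. (h \<bullet> b) *\<^sub>R b)"
      by (simp only: euclidean_representation)
    also have "\<dots> = (\<Sum>b\<in>Basis. (h \<bullet> b) *\<^sub>R f' b)"
      by (simp add: linear_sum[OF lin] linear_scale[OF lin])
    finally show "f' h = h \<bullet> (\<Sum>b\<in>Basis. f' b *\<^sub>R b)"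
      by (simp add: inner_sum_right mult.commute)
  qed
  from this f' have ex: "GDERIV f x :> (\<Sum>b\<in>Basis. f' b *\<^sub>R b)"
    unfolding gderiv_def by (rule subst[where P = "\<lambda>g. (f has_derivative g) (at x)"])
  have unique: "D = E" if "GDERIV f x :> D" "GDERIV f x :> E" for D E
  proof -
    have "(\<lambda>h. h \<bullet> D) = (\<lambda>h. h \<bullet> E)"
      using that unfolding gderiv_def by (rule has_derivative_unique)
    then show ?thesis
      unfolding fun_eq_iff by (rule iffD1[OF vector_eq_ldot])
  qed
  show ?thesis
    unfolding gradient_def by (rule theI[where P = "\<lambda>D. GDERIV f x :> D", OF ex]) (rule unique[OF _ ex])
qed

text \<open>
  A decomposition of the coordinates into blocks is given by a map \<open>blk\<close> sending each coordinate
  to the index of its block. The number of coordinates in block \<open>i\<close>, and hence the type of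
  \<open>n \<times> n\<^sub>i\<close> matrices, depends on the value \<open>i\<close>. Therefore the space of dimension \<open>n\<^sub>i\<close> is
  represented by \<open>block_space blk i\<close>, the vectors supported on block \<open>i\<close>, and the matrix
  \<open>block_mat blk i\<close> is padded to a square one: the columns of the identity matrix belonging to
  block \<open>i\<close> are kept, the others are replaced by zero columns.
\<close>

definition block_space :: "('n::finite \<Rightarrow> nat) \<Rightarrow> nat \<Rightarrow> (real ^ 'n) set"
  where "block_space blk i = {h. \<forall>j. blk j \<noteq> i \<longrightarrow> h $ j = 0}"

definition block_mat :: "('n::finite \<Rightarrow> nat) \<Rightarrow> nat \<Rightarrow> real ^ 'n ^ 'n"
  where "block_mat blk i = (\<chi> r c. if blk c = i then (mat 1 :: real ^ 'n ^ 'n) $ r $ c else 0)"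

definition block :: "('n::finite \<Rightarrow> nat) \<Rightarrow> nat \<Rightarrow> real ^ 'n \<Rightarrow> real ^ 'n"
  where "block blk i x = transpose (block_mat blk i) *v x"

definition block_gradient ::
    "('n::finite \<Rightarrow> nat) \<Rightarrow> (real ^ 'n \<Rightarrow> real) \<Rightarrow> nat \<Rightarrow> real ^ 'n \<Rightarrow> real ^ 'n"
  where "block_gradient blk f i x = transpose (block_mat blk i) *v gradient f x"

lemma block_mat_nth: "block_mat blk i $ r $ c = (if r = c \<and> blk c = i then 1 else 0)"
  by (simp add: block_mat_def mat_def)

lemma block_nth: "block blk i x $ j = (if blk j = i then x $ j else 0)"
proof -
  have "block blk i x $ j = (\<Sum>r\<in>UNIV. block_mat blk i $ r $ j * x $ r)"
    by (simp add: block_def matrix_vector_mult_def transpose_def)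
  also have "\<dots> = (\<Sum>r\<in>UNIV. if r = j then (if blk j = i then x $ r else 0) else 0)"
    by (rule sum.cong) (simp_all add: block_mat_nth)
  finally show ?thesis
    by simp
qed

lemma block_in_block_space: "block blk i x \<in> block_space blk i"
  by (simp add: block_space_def block_nth)

lemma block_mat_mult_block_space:
  assumes "h \<in> block_space blk i"
  shows "block_mat blk i *v h = h"
proof (rule vec_eq_iff[THEN iffD2], rule allI)
  fix j
  have "(block_mat blk i *v h) $ j = (\<Sum>c\<in>UNIV. block_mat blk i $ j $ c * h $ c)"
    by (simp add: matrix_vector_mult_def)
  also have "\<dots> = (\<Sum>c\<in>UNIV. if c = j then (if blk j = i then h $ c else 0) else 0)"
    by (rule sum.cong) (auto simp: block_mat_nth)
  finally show "(block_mat blk i *v h) $ j = h $ j"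
    using assms by (simp add: block_space_def)
qed

definition weighted_norm ::
    "('n::finite \<Rightarrow> nat) \<Rightarrow> nat \<Rightarrow> (nat \<Rightarrow> real) \<Rightarrow> real ^ 'n \<Rightarrow> real"
  where "weighted_norm blk d L x = sqrt (\<Sum>i = 1..d. L i * (norm (block blk i x))\<^sup>2)"

end

theory Submission
  imports Defs
begin

text \<open>
  Write \<open>g\<close> for the gradient at \<open>x\<^sub>0\<close>, \<open>g\<^sub>i\<close> for its block \<open>i\<close>, \<open>F = f x\<^sub>0 - f xs\<close> and
  \<open>q\<^sub>i = \<parallel>g\<^sub>i\<parallel>\<^sup>2 / (2 L\<^sub>i)\<close>. A step along block \<open>i\<close> lowers \<open>f\<close> by at least \<open>q\<^sub>i\<close>
  (\<open>block_step_decrease\<close>), and expanding the square it changes half the squared weighted distance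
  to \<open>xs\<close> by exactly \<open>q\<^sub>i - g\<^sub>i \<bullet> (x\<^sub>0 - xs)\<close>. Averaging over \<open>i\<close>, the potential is in expectation
  at most
  \<open>(d - 1) * F + d / 2 * \<parallel>x\<^sub>0 - xs\<parallel>\<^sub>L\<^sup>2 - g \<bullet> (x\<^sub>0 - xs) + (\<Sum>i = 1..d. q\<^sub>i) / d\<close>.
  The plain gradient inequality \<open>g \<bullet> (x\<^sub>0 - xs) \<ge> F\<close> would leave the average of the \<open>q\<^sub>i\<close> over.
  What saves the estimate is that convexity and blockwise smoothness together give the stronger
  \<open>g \<bullet> (x\<^sub>0 - xs) \<ge> F + q\<^sub>i\<close> for every single \<open>i\<close> (\<open>convex_block_smooth_lower_bound\<close>): move from
  the minimizer by \<open>g\<^sub>i / L\<^sub>i\<close>, bound \<open>f\<close> at the point reached from below by its tangent plane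
  at \<open>x\<^sub>0\<close> and from above by smoothness. Averaging these bounds absorbs the left-over term.
\<close>

lemma block_gradient_eq_block: "block_gradient blk f i x = block blk i (gradient f x)"
  by (simp add: block_gradient_def block_def)

lemma block_mat_mult_block_gradient:
  "block_mat blk i *v block_gradient blk f i x = block_gradient blk f i x"
  by (simp add: block_gradient_eq_block block_in_block_space block_mat_mult_block_space)

lemma inner_block_space:
  assumes "h \<in> block_space blk i"
  shows "block blk i x \<bullet> h = x \<bullet> h"
  unfolding inner_vec_def
  by (rule sum.cong) (use assms in \<open>auto simp: block_nth block_space_def\<close>)

lemma block_space_scaleR: "h \<in> block_space blk i \<Longrightarrow> c *\<^sub>R h \<in> block_space blk i"
  by (simp add: block_space_def)

lemma sum_block:
  assumes "finite A" "\<And>j. blk j \<in> A"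
  shows "(\<Sum>i\<in>A. block blk i x) = x"
  using assms by (simp add: vec_eq_iff block_nth)

lemma block_add_block_space:
  assumes "h \<in> block_space blk i"
  shows "block blk k (x + h) = block blk k x + (if k = i then h else 0)"
  using assms by (auto simp: vec_eq_iff block_nth block_space_def)

lemma weighted_norm_add_block_space:
  assumes "i \<in> {1..d}" and "h \<in> block_space blk i" and L: "\<And>k. k \<in> {1..d} \<Longrightarrow> L k > 0"
  shows "(weighted_norm blk d L (x + h))\<^sup>2
           = (weighted_norm blk d L x)\<^sup>2 + L i * (2 * (x \<bullet> h) + (norm h)\<^sup>2)"
proof -
  have sq: "(weighted_norm blk d L y)\<^sup>2 = (\<Sum>k = 1..d. L k * (norm (block blk k y))\<^sup>2)" for y
    unfolding weighted_norm_def
    by (intro real_sqrt_pow2 sum_nonneg mult_nonneg_nonneg) (auto intro: less_imp_le[OF L])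
  have "L k * (norm (block blk k (x + h)))\<^sup>2 = L k * (norm (block blk k x))\<^sup>2
          + (if k = i then L i * (2 * (x \<bullet> h) + (norm h)\<^sup>2) else 0)" for k
    using inner_block_space[OF assms(2), of x] unfolding block_add_block_space[OF assms(2)]
    by (simp add: power2_norm_eq_inner inner_add_left inner_add_right
        inner_commute[of h "block blk i x"] distrib_left)
  then show ?thesis
    using assms(1) by (simp add: sq sum.distrib)
qed

lemma DERIV_along_line:
  fixes f :: "'a::euclidean_space \<Rightarrow> real"
  assumes "f differentiable (at (x + t *\<^sub>R h))"
  shows "((\<lambda>t. f (x + t *\<^sub>R h)) has_real_derivative (gradient f (x + t *\<^sub>R h) \<bullet> h)) (at t)"
proof -
  have "(f has_derivative (\<lambda>v. v \<bullet> gradient f (x + t *\<^sub>R h))) (at (x + t *\<^sub>R h))"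
    using GDERIV_gradient[OF assms] by (simp add: gderiv_def)
  moreover have "((\<lambda>t. x + t *\<^sub>R h) has_derivative (\<lambda>s. s *\<^sub>R h)) (at t)"
    by (auto intro!: derivative_eq_intros)
  ultimately have "((\<lambda>t. f (x + t *\<^sub>R h)) has_derivative
      (\<lambda>s. (s *\<^sub>R h) \<bullet> gradient f (x + t *\<^sub>R h))) (at t)"
    by (rule has_derivative_compose[rotated])
  then show ?thesis
    by (simp add: has_field_derivative_def inner_commute mult_commute_abs)
qed

lemma convex_on_above_tangent_plane:
  fixes f :: "'a::euclidean_space \<Rightarrow> real"
  assumes "convex_on UNIV f" and "f differentiable (at x)"
  shows "f x + gradient f x \<bullet> (z - x) \<le> f z"
proof -
  let ?\<phi> = "\<lambda>t. f (x + t *\<^sub>R (z - x))"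
  have "convex_on UNIV ?\<phi>"
  proof (rule convex_onI)
    fix t a b :: real
    assume t: "0 < t" "t < 1"
    have "x + ((1 - t) *\<^sub>R a + t *\<^sub>R b) *\<^sub>R (z - x)
        = (1 - t) *\<^sub>R (x + a *\<^sub>R (z - x)) + t *\<^sub>R (x + b *\<^sub>R (z - x))"
      by (simp add: algebra_simps)
    then show "?\<phi> ((1 - t) *\<^sub>R a + t *\<^sub>R b) \<le> (1 - t) * ?\<phi> a + t * ?\<phi> b"
      using convex_onD[OF assms(1), of t "x + a *\<^sub>R (z - x)" "x + b *\<^sub>R (z - x)"] t by simp
  qed simp
  moreover have "(?\<phi> has_real_derivative (gradient f x \<bullet> (z - x))) (at 0)"
    using DERIV_along_line[of f x 0 "z - x"] assms(2) by simp
  ultimately have "?\<phi> 1 - ?\<phi> 0 \<ge> (gradient f x \<bullet> (z - x)) * (1 - 0)"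
    by (intro convex_on_imp_above_tangent[where A = UNIV]) auto
  then show ?thesis
    by simp
qed

text \<open>
  The descent lemma restricted to a block: along the segment from \<open>x\<close> to \<open>x + h\<close> the slope
  at time \<open>t\<close> exceeds the initial one by at most \<open>t * L * \<parallel>h\<parallel>\<^sup>2\<close>, because only block \<open>i\<close> of the
  gradient is tested against \<open>h\<close>.
\<close>

lemma block_smooth_upper_bound:
  fixes f :: "real ^ 'n::finite \<Rightarrow> real"
  assumes diff: "\<And>x. f differentiable (at x)"
    and lip: "\<And>x h. h \<in> block_space blk i \<Longrightarrow>
           norm (block_gradient blk f i (x + h) - block_gradient blk f i x) \<le> L * norm h"
    and h: "h \<in> block_space blk i"
  shows "f (x + h) \<le> f x + gradient f x \<bullet> h + L / 2 * (norm h)\<^sup>2"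
proof -
  let ?\<phi> = "\<lambda>t. f (x + t *\<^sub>R h) - t * (gradient f x \<bullet> h) - L / 2 * t\<^sup>2 * (norm h)\<^sup>2"
  have "\<exists>y. (?\<phi> has_real_derivative y) (at t) \<and> y \<le> 0" if t: "0 \<le> t" for t
  proof (intro exI conjI)
    let ?y = "gradient f (x + t *\<^sub>R h) \<bullet> h - gradient f x \<bullet> h - L * t * (norm h)\<^sup>2"
    show "(?\<phi> has_real_derivative ?y) (at t)"
      by (rule derivative_eq_intros DERIV_along_line diff refl | simp)+
    have "gradient f (x + t *\<^sub>R h) \<bullet> h - gradient f x \<bullet> h
        = (block_gradient blk f i (x + t *\<^sub>R h) - block_gradient blk f i x) \<bullet> h"
      by (simp add: block_gradient_eq_block inner_diff_left inner_block_space[OF h])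
    also have "\<dots> \<le> norm (block_gradient blk f i (x + t *\<^sub>R h) - block_gradient blk f i x) * norm h"
      by (rule norm_cauchy_schwarz)
    also have "\<dots> \<le> (L * norm (t *\<^sub>R h)) * norm h"
      by (intro mult_right_mono lip block_space_scaleR h) simp
    also have "\<dots> = L * t * (norm h)\<^sup>2"
      using t by (simp add: power2_eq_square)
    finally show "?y \<le> 0"
      by simp
  qed
  then have "?\<phi> 1 \<le> ?\<phi> 0"
    by (intro DERIV_nonpos_imp_nonincreasing[of 0 1 ?\<phi>]) auto
  then show ?thesis
    by simp
qed

text \<open>The step length \<open>1 / L\<close> minimizes the quadratic upper bound along the block gradient.\<close>

lemma block_step_decrease:
  fixes f :: "real ^ 'n::finite \<Rightarrow> real"
  assumes "\<And>x. f differentiable (at x)"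
    and "\<And>x h. h \<in> block_space blk i \<Longrightarrow>
           norm (block_gradient blk f i (x + h) - block_gradient blk f i x) \<le> L * norm h"
    and "L > 0"
  shows "f (x - (1 / L) *\<^sub>R block_gradient blk f i x)
           \<le> f x - (norm (block_gradient blk f i x))\<^sup>2 / (2 * L)"
proof -
  let ?b = "block_gradient blk f i x"
  have b: "?b \<in> block_space blk i"
    by (simp add: block_gradient_eq_block block_in_block_space)
  have "gradient f x \<bullet> ?b = (norm ?b)\<^sup>2"
    using inner_block_space[OF b, of "gradient f x"]
    by (simp add: block_gradient_eq_block power2_norm_eq_inner)
  then have "f (x + (- 1 / L) *\<^sub>R ?b)
      \<le> f x - (norm ?b)\<^sup>2 / L + L / 2 * (norm ?b / L)\<^sup>2"
    using block_smooth_upper_bound[of f blk i L, OF assms(1,2) block_space_scaleR[OF b, of "- 1 / L"], of x]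
      \<open>L > 0\<close> by simp
  then show ?thesis
    using \<open>L > 0\<close> by (simp add: power2_eq_square field_simps)
qed

text \<open>
  Cocoercivity localized to one block: the tangent plane at \<open>x\<close> lies below \<open>f\<close> at the shifted
  point \<open>xs + g\<^sub>i / L\<close>, where it is higher than at \<open>xs\<close> by \<open>\<parallel>g\<^sub>i\<parallel>\<^sup>2 / L\<close>; since the gradient
  vanishes at the minimizer \<open>xs\<close>, smoothness lets \<open>f\<close> grow by at most half of this.
\<close>

lemma convex_block_smooth_lower_bound:
  fixes f :: "real ^ 'n::finite \<Rightarrow> real"
  assumes diff: "\<And>x. f differentiable (at x)"
    and "\<And>x h. h \<in> block_space blk i \<Longrightarrow>
           norm (block_gradient blk f i (x + h) - block_gradient blk f i x) \<le> L * norm h"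
    and "L > 0" and "convex_on UNIV f" and min: "\<And>x. f xs \<le> f x"
  shows "f x - f xs + (norm (block_gradient blk f i x))\<^sup>2 / (2 * L) \<le> gradient f x \<bullet> (x - xs)"
proof -
  let ?b = "block_gradient blk f i x"
  let ?h = "(1 / L) *\<^sub>R ?b"
  have b: "?b \<in> block_space blk i"
    by (simp add: block_gradient_eq_block block_in_block_space)
  have "(\<lambda>v. v \<bullet> gradient f xs) = (\<lambda>v. 0)"
    using GDERIV_gradient[OF diff, of xs] min unfolding gderiv_def
    by (intro differential_zero_maxmin[of xs UNIV f]) auto
  then have "gradient f xs = 0"
    by (metis inner_eq_zero_iff)
  then have "f (xs + ?h) \<le> f xs + L / 2 * (norm ?b / L)\<^sup>2"
    using block_smooth_upper_bound[of f blk i L, OF assms(1,2) block_space_scaleR[OF b, of "1 / L"], of xs]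
      \<open>L > 0\<close> by simp
  also have "L / 2 * (norm ?b / L)\<^sup>2 = (norm ?b)\<^sup>2 / (2 * L)"
    using \<open>L > 0\<close> by (simp add: power2_eq_square)
  finally have upper: "f (xs + ?h) \<le> f xs + (norm ?b)\<^sup>2 / (2 * L)" .
  have "gradient f x \<bullet> ?b = (norm ?b)\<^sup>2"
    using inner_block_space[OF b, of "gradient f x"]
    by (simp add: block_gradient_eq_block power2_norm_eq_inner)
  then have "f x - gradient f x \<bullet> (x - xs) + (norm ?b)\<^sup>2 / L \<le> f (xs + ?h)"
    using convex_on_above_tangent_plane[OF assms(4) diff, of x "xs + ?h"]
    by (simp add: inner_diff_right inner_add_right)
  moreover have "(norm ?b)\<^sup>2 / L = 2 * ((norm ?b)\<^sup>2 / (2 * L))"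
    by simp
  ultimately show ?thesis
    using upper by linarith
qed

lemma expectation_uniform_index:
  fixes h :: "nat \<Rightarrow> real"
  assumes "d \<ge> 1" and "I \<in> measurable M (count_space UNIV)"
    and "distr M (count_space UNIV) I = measure_pmf (pmf_of_set {1..d})"
  shows "(\<integral>\<omega>. h (I \<omega>) \<partial>M) = (\<Sum>i = 1..d. h i) / real d"
proof -
  have "(\<integral>\<omega>. h (I \<omega>) \<partial>M) = (\<integral>i. h i \<partial>distr M (count_space UNIV) I)"
    using assms(2) by (simp add: integral_distr)
  also have "\<dots> = (\<Sum>i = 1..d. h i) / real d"
    using assms(1) unfolding assms(3) by (subst integral_pmf_of_set) auto
  finally show ?thesis .
qed

theorem proposition1:
  fixes d :: nat
    and blk :: "'n::finite \<Rightarrow> nat"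
    and f :: "real ^ 'n \<Rightarrow> real"
    and L :: "nat \<Rightarrow> real"
    and x\<^sub>0 xs :: "real ^ 'n"
    and M :: "'w measure"
    and I\<^sub>1 :: "'w \<Rightarrow> nat"
    and x\<^sub>1 :: "'w \<Rightarrow> real ^ 'n"
  assumes "d \<ge> 1"
    and "\<And>j. blk j \<in> {1..d}"
    and "convex_on UNIV f"
    and "\<And>x. f differentiable (at x)"
    and "\<And>i. i \<in> {1..d} \<Longrightarrow> L i > 0"
    and "\<And>i x h. i \<in> {1..d} \<Longrightarrow> h \<in> block_space blk i \<Longrightarrow>
           norm (block_gradient blk f i (x + block_mat blk i *v h) - block_gradient blk f i x)
             \<le> L i * norm h"
    and "\<And>x. f xs \<le> f x"
    and "prob_space M"
    and "I\<^sub>1 \<in> measurable M (count_space UNIV)"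
    and "distr M (count_space UNIV) I\<^sub>1 = measure_pmf (pmf_of_set {1..d})"
    and "\<And>\<omega>. \<omega> \<in> space M \<Longrightarrow>
           x\<^sub>1 \<omega> = x\<^sub>0 - (1 / L (I\<^sub>1 \<omega>)) *\<^sub>R
                        (block_mat blk (I\<^sub>1 \<omega>) *v block_gradient blk f (I\<^sub>1 \<omega>) x\<^sub>0)"
  shows "prob_space.expectation M (\<lambda>\<omega>. (real d - 1) * (f (x\<^sub>1 \<omega>) - f xs)
             + real d / 2 * (weighted_norm blk d L (x\<^sub>1 \<omega> - xs))\<^sup>2)
         \<le> (real d - 2) * (f x\<^sub>0 - f xs) + real d / 2 * (weighted_norm blk d L (x\<^sub>0 - xs))\<^sup>2"
proof -
  let ?y = "\<lambda>i. x\<^sub>0 - (1 / L i) *\<^sub>R block_gradient blk f i x\<^sub>0"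
  let ?F = "f x\<^sub>0 - f xs" and ?W = "(weighted_norm blk d L (x\<^sub>0 - xs))\<^sup>2"
  let ?p = "gradient f x\<^sub>0 \<bullet> (x\<^sub>0 - xs)"
  let ?p' = "\<lambda>i. block_gradient blk f i x\<^sub>0 \<bullet> (x\<^sub>0 - xs)"
  let ?V = "\<lambda>i. (real d - 1) * (f (?y i) - f xs)
                  + real d / 2 * (weighted_norm blk d L (?y i - xs))\<^sup>2"
  have lip: "norm (block_gradient blk f i (x + h) - block_gradient blk f i x) \<le> L i * norm h"
    if "i \<in> {1..d}" "h \<in> block_space blk i" for i x h
    using assms(6)[OF that, of x] by (simp add: block_mat_mult_block_space[OF that(2)])
  \<comment> \<open>Spending the surplus \<open>q\<close> of the lower bound in each outcome separately leaves, besides the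
    claimed bound, only a summand that averages to zero, since the \<open>?p' i\<close> add up to \<open>?p\<close>.\<close>
  have V: "?V i \<le> (real d - 2) * ?F + real d / 2 * ?W + (?p - real d * ?p' i)"
    if i: "i \<in> {1..d}" for i
  proof -
    let ?b = "block_gradient blk f i x\<^sub>0"
    define q where "q = (norm ?b)\<^sup>2 / (2 * L i)"
    have Li: "L i > 0"
      by (rule assms(5)[OF i])
    have dec: "f (?y i) - f xs \<le> ?F - q"
      using block_step_decrease[of f blk i "L i", OF assms(4) lip[OF i] Li, of x\<^sub>0] by (simp add: q_def)
    have low: "?F + q \<le> ?p"
      using convex_block_smooth_lower_bound[of f blk i "L i", OF assms(4) lip[OF i] Li assms(3,7), of x\<^sub>0]
      by (simp add: q_def)
    have "(- (1 / L i)) *\<^sub>R ?b \<in> block_space blk i"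
      by (intro block_space_scaleR) (simp add: block_gradient_eq_block block_in_block_space)
    from weighted_norm_add_block_space[where L = L and x = "x\<^sub>0 - xs", OF i this assms(5)]
    have "(weighted_norm blk d L (?y i - xs))\<^sup>2
        = ?W + L i * (2 * ((- (1 / L i)) * ?p' i) + (norm ?b / L i)\<^sup>2)"
      using Li by (simp add: inner_commute[of ?b]
          cancel_ab_semigroup_add_class.diff_right_commute[of "x\<^sub>0" _ xs])
    also have "\<dots> = ?W + (2 * q - 2 * ?p' i)"
      using Li by (simp add: q_def power2_eq_square field_simps)
    finally have W: "(weighted_norm blk d L (?y i - xs))\<^sup>2 = ?W + (2 * q - 2 * ?p' i)" .
    have "?V i \<le> (real d - 1) * (?F - q) + real d / 2 * (?W + (2 * q - 2 * ?p' i))"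
      unfolding W using assms(1) by (intro add_mono mult_left_mono dec) auto
    also have "\<dots> = (real d - 1) * ?F + q + real d / 2 * ?W - real d * ?p' i"
      by (simp add: algebra_simps)
    also have "\<dots> \<le> (real d - 1) * ?F + (?p - ?F) + real d / 2 * ?W - real d * ?p' i"
      using low by simp
    finally show ?thesis
      by (simp add: algebra_simps)
  qed
  have "(\<Sum>i = 1..d. ?p' i) = ?p"
    by (simp add: block_gradient_eq_block inner_sum_left[symmetric] sum_block[OF finite_atLeastAtMost assms(2)]
        del: One_nat_def)
  then have sum0: "(\<Sum>i = 1..d. ?p - real d * ?p' i) = 0"
    by (simp add: sum_subtractf sum_distrib_left[symmetric])
  have "(\<integral>\<omega>. (real d - 1) * (f (x\<^sub>1 \<omega>) - f xs)
             + real d / 2 * (weighted_norm blk d L (x\<^sub>1 \<omega> - xs))\<^sup>2 \<partial>M) = (\<integral>\<omega>. ?V (I\<^sub>1 \<omega>) \<partial>M)"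
    by (rule Bochner_Integration.integral_cong) (simp_all add: assms(11) block_mat_mult_block_gradient)
  also have "\<dots> = (\<Sum>i = 1..d. ?V i) / real d"
    by (rule expectation_uniform_index[OF assms(1,9,10)])
  also have "\<dots> \<le> (\<Sum>i = 1..d. (real d - 2) * ?F + real d / 2 * ?W + (?p - real d * ?p' i)) / real d"
    by (intro divide_right_mono sum_mono V) auto
  also have "\<dots> = (real d - 2) * ?F + real d / 2 * ?W"
    unfolding sum.distrib sum0 using assms(1) by (simp add: add_divide_distrib)
  finally show ?thesis .
qed

end
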